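(* Let $H$ and $K$ be two inner product spaces (either both real or both complex) with $\dim(H)\ge 2$, and let $A:H\to K$ be an additive orthogonality preserving mapping. Then $A$ is real-linear and there exists a unique extension of $A$ to a real-linear orthogonality preserving map between the completions of $H$ and $K$.
   Context: A mapping $A:H\to K$ is additive if $A(x+y)=A(x)+A(y)$ for all $x,y\in H$. A mapping between inner product spaces preserves orthogonality if it sends any two vectors $x,y$ with $\langle x|y\rangle=0$ to two vectors with zero inner product. The dimension $\dim(H)$ is taken over the scalar field of $H$. *)

theory Defs
  imports "HOL-Analysis.Analysis"
begin

section \<open>Complex inner product spaces\<close>

class complex_vector = real_vector +
  fixes scaleC :: "complex \<Rightarrow> 'a \<Rightarrow> 'a"  (infixr \<open>*\<^sub>C\<close> 75)
  assumes scaleC_add_right: "a *\<^sub>C (x + y) = a *\<^sub>C x + a *\<^sub>C y"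
    and scaleC_add_left: "(a + b) *\<^sub>C x = a *\<^sub>C x + b *\<^sub>C x"
    and scaleC_scaleC: "a *\<^sub>C b *\<^sub>C x = (a * b) *\<^sub>C x"
    and scaleC_one: "1 *\<^sub>C x = x"
    and scaleR_scaleC: "r *\<^sub>R x = complex_of_real r *\<^sub>C x"

global_interpretation complex_vector: vector_space "scaleC :: complex \<Rightarrow> 'a \<Rightarrow> 'a::complex_vector"
  by unfold_locales
    (simp_all add: scaleC_add_right scaleC_add_left scaleC_scaleC scaleC_one)

text \<open>
  Every complex inner product space is a real one, with scalars restricted to the reals and
  the real part of the inner product. The class is therefore an extension of
  \<^class>\<open>real_inner\<close>, from which it inherits positive definiteness, norm and topology
  (see \<open>cinner_self\<close>). The inner product is linear in its first argument.
\<close>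

class complex_inner = complex_vector + real_inner +
  fixes cinner :: "'a \<Rightarrow> 'a \<Rightarrow> complex"
  assumes cinner_commute: "cinner x y = cnj (cinner y x)"
    and cinner_add_left: "cinner (x + y) z = cinner x z + cinner y z"
    and cinner_scaleC_left: "cinner (a *\<^sub>C x) y = a * cinner x y"
    and inner_eq_Re_cinner: "inner x y = Re (cinner x y)"

lemma cinner_self: "cinner x x = complex_of_real ((norm x)\<^sup>2)"
  for x :: "'a::complex_inner"
proof (rule complex_eqI)
  show "Re (cinner x x) = Re (complex_of_real ((norm x)\<^sup>2))"
    by (simp only: inner_eq_Re_cinner [symmetric] power2_norm_eq_inner Re_complex_of_real)
  have "Im (cinner x x) = Im (cnj (cinner x x))"
    using cinner_commute [of x x] by simp
  then show "Im (cinner x x) = Im (complex_of_real ((norm x)\<^sup>2))"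
    by simp
qed

instantiation complex :: complex_inner
begin

definition scaleC_complex :: "complex \<Rightarrow> complex \<Rightarrow> complex"
  where "scaleC_complex a x = a * x"

definition cinner_complex :: "complex \<Rightarrow> complex \<Rightarrow> complex"
  where "cinner_complex x y = x * cnj y"

instance
  by intro_classes
    (simp_all add: scaleC_complex_def cinner_complex_def algebra_simps scaleR_conv_of_real
      inner_complex_def)

end

abbreviation clinear :: "('a::complex_vector \<Rightarrow> 'b::complex_vector) \<Rightarrow> bool"
  where "clinear \<equiv> Vector_Spaces.linear scaleC scaleC"

section \<open>Dimension\<close>

text \<open>
  The library's \<open>dim\<close> is \<open>0\<close> for an infinite-dimensional space, so lower bounds on the
  dimension are stated here through the cardinality of a basis that may be infinite.
\<close>

definition (in vector_space) dim_at_least :: "nat \<Rightarrow> bool"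
  where "dim_at_least n \<longleftrightarrow>
    (\<exists>B. independent B \<and> span B = UNIV \<and> (infinite B \<or> n \<le> card B))"

section \<open>Orthogonality preserving maps\<close>

definition preserves_orthogonality :: "('a::real_inner \<Rightarrow> 'b::real_inner) \<Rightarrow> bool"
  where "preserves_orthogonality f \<longleftrightarrow> (\<forall>x y. inner x y = 0 \<longrightarrow> inner (f x) (f y) = 0)"

definition preserves_corthogonality :: "('a::complex_inner \<Rightarrow> 'b::complex_inner) \<Rightarrow> bool"
  where "preserves_corthogonality f \<longleftrightarrow> (\<forall>x y. cinner x y = 0 \<longrightarrow> cinner (f x) (f y) = 0)"

section \<open>Completions\<close>

text \<open>
  A completion of an inner product space is a Hilbert space together with an inner product
  preserving linear embedding with dense range; it is unique up to a unitary isomorphism that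
  is compatible with the embeddings.
\<close>

definition is_completion :: "('a::real_inner \<Rightarrow> 'c::{real_inner, complete_space}) \<Rightarrow> bool"
  where "is_completion \<iota> \<longleftrightarrow>
    linear \<iota> \<and> (\<forall>x y. inner (\<iota> x) (\<iota> y) = inner x y) \<and> closure (range \<iota>) = UNIV"

definition is_ccompletion :: "('a::complex_inner \<Rightarrow> 'c::{complex_inner, complete_space}) \<Rightarrow> bool"
  where "is_ccompletion \<iota> \<longleftrightarrow>
    clinear \<iota> \<and> (\<forall>x y. cinner (\<iota> x) (\<iota> y) = cinner x y) \<and> closure (range \<iota>) = UNIV"

end

theory Submission
  imports Defs
begin

text \<open>
  The theorem comes down to one fact: an additive orthogonality preserving map multiplies all
  norms by a constant and is real-linear. Take orthogonal \<open>x\<close>, \<open>y\<close> of equal norm. Then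
  \<open>a x + b y\<close> and \<open>c x + d y\<close> are orthogonal whenever the real numbers satisfy \<open>a c + b d = 0\<close>,
  so \<open>\<langle>A (a x), A (c x)\<rangle>\<close> equals \<open>\<langle>A (b y), A (d y)\<rangle>\<close> whenever \<open>a c = b d\<close>. Hence
  \<open>\<langle>A (a x), A (c x)\<rangle> = g (a c)\<close> for an additive function \<open>g\<close> that is nonnegative on squares. Such
  a function is \<open>g t = t (g 1)\<close>. Expanding \<open>\<parallel>A (t x) - t A x\<parallel>\<^sup>2\<close> with this formula gives \<open>0\<close>, and
  \<open>\<parallel>A x\<parallel>\<^sup>2 = g 1 = \<parallel>A y\<parallel>\<^sup>2\<close> (lemma \<open>perp_frame\<close>). In dimension at least two every
  vector is orthogonal to some nonzero vector, and Pythagoras' theorem compares the norms of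
  arbitrary pairs (lemma \<open>norm_proportional\<close>).

  Real and complex orthogonality enter only through a few common properties, collected in the
  locale \<open>orthogonality\<close>. The norm identity makes \<open>A\<close> uniformly continuous, which gives the
  extension to the completion. It satisfies the same norm identity, from which real orthogonality
  is preserved by polarization. Complex orthogonality is not determined by the real inner product;
  there, since the extension need not be complex-linear, one approximates an orthogonal pair by
  orthogonal pairs of the dense subspace. For uniqueness, the fact above is applied once more, to a competing extension on the completion: it is
  automatically continuous, hence determined by its values on a dense set.
\<close>

section \<open>Additive functions that are nonnegative on the nonnegative reals\<close>

lemma additive_of_nat_mult:
  fixes g :: "real \<Rightarrow> real"
  assumes "Modules.additive g"
  shows "g (of_nat n * t) = of_nat n * g t"
  using assms
  by (induction n) (simp_all add: additive.zero additive.add distrib_right)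

lemma additive_nonneg_imp_linear:
  fixes g :: "real \<Rightarrow> real"
  assumes g: "Modules.additive g" and nonneg: "\<And>t. 0 \<le> t \<Longrightarrow> 0 \<le> g t"
  shows "g t = t * g 1"
proof -
  have mono: "g s \<le> g t" if "s \<le> t" for s t
    using nonneg[of "t - s"] that by (simp add: additive.diff[OF g])
  have g_int: "g (of_int m) = of_int m * g 1" for m
  proof (cases m)
    case (nonneg n)
    then show ?thesis using additive_of_nat_mult[OF g, of n 1] by simp
  next
    case (neg n)
    then show ?thesis
      using additive_of_nat_mult[OF g, of "Suc n" 1] additive.minus[OF g, of "of_nat (Suc n)"]
      by (simp del: of_nat_Suc)
  qed
  \<comment> \<open>Between consecutive integers \<open>g\<close> varies by at most \<open>g 1\<close>, so the error at the point
    \<open>n t\<close>, which is \<open>n\<close> times the error at \<open>t\<close>, is bounded independently of \<open>n\<close>.\<close>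
  have bounded: "of_nat n * \<bar>g t - t * g 1\<bar> \<le> g 1" for n
  proof -
    define m where "m = \<lfloor>of_nat n * t\<rfloor>"
    have m: "of_int m \<le> of_nat n * t" "of_nat n * t \<le> of_int (m + 1)"
      unfolding m_def by linarith+
    have "of_int m * g 1 \<le> of_nat n * g t" "of_nat n * g t \<le> of_int (m + 1) * g 1"
      using mono[OF m(1)] mono[OF m(2)] by (simp_all only: g_int additive_of_nat_mult[OF g])
    moreover have "of_int m * g 1 \<le> of_nat n * t * g 1"
      "of_nat n * t * g 1 \<le> of_int (m + 1) * g 1"
      using m nonneg[of 1] by (auto intro: mult_right_mono)
    ultimately have "\<bar>of_nat n * g t - of_nat n * t * g 1\<bar> \<le> g 1"
      by (simp add: distrib_right abs_le_iff)
    moreover have "of_nat n * \<bar>g t - t * g 1\<bar> = \<bar>of_nat n * g t - of_nat n * t * g 1\<bar>"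
      proof -
      have "of_nat n * g t - of_nat n * t * g 1 = of_nat n * (g t - t * g 1)"
        by (simp add: algebra_simps)
      then show ?thesis by (simp add: abs_mult)
    qed
    ultimately show ?thesis by simp
  qed
  show ?thesis
  proof (rule ccontr)
    assume "g t \<noteq> t * g 1"
    then obtain n where "g 1 < of_nat n * \<bar>g t - t * g 1\<bar>"
      using ex_less_of_nat_mult[of "\<bar>g t - t * g 1\<bar>" "g 1"] by auto
    with bounded[of n] show False by simp
  qed
qed

section \<open>Abstract orthogonality\<close>

lemma norm_add_Pythagorean_inner:
  fixes u v :: "'a::real_inner"
  assumes "inner u v = 0"
  shows "(norm (u + v))\<^sup>2 = (norm u)\<^sup>2 + (norm v)\<^sup>2"
  using assms by (simp add: power2_norm_eq_inner inner_add_left inner_add_right inner_commute)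

text \<open>
  The common part of real and complex orthogonality. By \<open>frame\<close>, two vectors of the real plane
  spanned by \<open>x\<close> and \<open>y\<close> are orthogonal if their real coordinate vectors are. In \<open>project\<close>, the
  vector \<open>p\<close> is the projection of \<open>y\<close> to the line through \<open>x\<close>; that it lies on this line is
  expressed by orthogonality alone, since the line may be real or complex.
\<close>

locale orthogonality =
  fixes perp :: "'a::real_inner \<Rightarrow> 'a \<Rightarrow> bool"
  assumes perp_sym: "perp x y \<Longrightarrow> perp y x"
    and perp_inner: "perp x y \<Longrightarrow> inner x y = 0"
    and perp_scaleR: "perp x y \<Longrightarrow> perp x (r *\<^sub>R y)"
    and frame: "\<lbrakk>perp x y; norm x = norm y; a * c + b * d = 0\<rbrakk>
      \<Longrightarrow> perp (a *\<^sub>R x + b *\<^sub>R y) (c *\<^sub>R x + d *\<^sub>R y)"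
    and project: "\<exists>p z. y = p + z \<and> perp x z \<and> (\<forall>w. perp x w \<longrightarrow> perp p w)"
    and nontrivial: "\<exists>x y. x \<noteq> 0 \<and> y \<noteq> 0 \<and> perp x y"
begin

lemma equal_norm_partner:
  assumes "perp x y" "x \<noteq> 0" "y \<noteq> 0"
  obtains r where "r \<noteq> 0" "perp x (r *\<^sub>R y)" "norm (r *\<^sub>R y) = norm x"
  using assms by (intro that[of "norm x / norm y"]) (simp_all add: perp_scaleR)

text \<open>
  Given one orthogonal pair \<open>u\<close>, \<open>v\<close>, split \<open>x = p + z\<close> along \<open>u\<close>. If \<open>p\<close> or \<open>z\<close> vanishes, one of
  \<open>u\<close>, \<open>v\<close> is a partner of \<open>x\<close>; otherwise a quarter turn in the plane of \<open>p\<close> and \<open>z\<close> gives one.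
\<close>

lemma ex_partner:
  obtains w where "w \<noteq> 0" "perp x w"
proof -
  obtain u v where uv: "u \<noteq> 0" "v \<noteq> 0" "perp u v" using nontrivial by blast
  obtain p z where pz: "x = p + z" "perp u z" and p: "\<And>w. perp u w \<Longrightarrow> perp p w"
    using project[of x u] by blast
  consider "z = 0" | "p = 0" | "z \<noteq> 0" "p \<noteq> 0" by blast
  then show thesis
  proof cases
    case 1
    then show thesis using that[of v] uv pz p by simp
  next
    case 2
    then show thesis using that[of u] uv pz by (simp add: perp_sym)
  next
    case 3
    obtain r where r: "r \<noteq> 0" "perp p (r *\<^sub>R z)" "norm (r *\<^sub>R z) = norm p"
      using equal_norm_partner[OF p[OF pz(2)] 3(2,1)] .
    define w where "w = (- 1 / r) *\<^sub>R p + 1 *\<^sub>R (r *\<^sub>R z)"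
    have "perp (1 *\<^sub>R p + (1 / r) *\<^sub>R (r *\<^sub>R z)) w"
      unfolding w_def by (rule frame) (use r in auto)
    moreover have "1 *\<^sub>R p + (1 / r) *\<^sub>R (r *\<^sub>R z) = x" using r pz by simp
    moreover have "inner w z = r * (norm z)\<^sup>2"
      using perp_inner[OF p[OF pz(2)]]
      by (simp add: w_def inner_diff_left power2_norm_eq_inner)
    then have "w \<noteq> 0" using r 3 by auto
    ultimately show thesis using that by simp
  qed
qed

end

section \<open>Additive orthogonality preserving maps\<close>

locale additive_orthogonal = orthogonality perp
  for perp :: "'a::real_inner \<Rightarrow> 'a \<Rightarrow> bool" +
  fixes A :: "'a \<Rightarrow> 'b::real_inner"
  assumes additive: "Modules.additive A"
    and preserves: "perp x y \<Longrightarrow> inner (A x) (A y) = 0"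
begin

lemmas A_add = additive.add[OF additive]
lemmas A_minus = additive.minus[OF additive]
lemmas A_zero = additive.zero[OF additive]

lemma perp_frame:
  assumes "perp x y" "norm x = norm y"
  shows "A (t *\<^sub>R x) = t *\<^sub>R A x" and "norm (A x) = norm (A y)"
proof -
  define G where "G a c = inner (A (a *\<^sub>R x)) (A (c *\<^sub>R x))" for a c
  define H where "H b d = inner (A (b *\<^sub>R y)) (A (d *\<^sub>R y))" for b d
  have cross: "inner (A (a *\<^sub>R x)) (A (d *\<^sub>R y)) = 0" for a d
    using preserves[OF frame[OF assms, of a 0 0 d]] by simp
  have "G a c + H b d = 0" if "a * c + b * d = 0" for a b c d
    using preserves[OF frame[OF assms that]] cross[of a d] cross[of c b]
    by (simp add: A_add inner_add_left inner_add_right G_def H_def inner_commute)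
  from this[of _ _ _ "- _"] have GH: "G a c = H b d" if "a * c = b * d" for a b c d
    using that by (simp add: H_def A_minus)
  define g where "g = H 1"
  have G: "G a c = g (a * c)" for a c
    unfolding g_def by (rule GH) simp
  have "Modules.additive g"
    by unfold_locales (simp add: g_def H_def scaleR_add_left A_add inner_add_right)
  moreover have "0 \<le> g s" if "0 \<le> s" for s
  proof -
    have "g s = G (sqrt s) (sqrt s)" using that by (simp add: G)
    then show ?thesis by (simp add: G_def)
  qed
  ultimately have g: "g s = s * g 1" for s
    by (rule additive_nonneg_imp_linear)
  have "(norm (A (t *\<^sub>R x) - t *\<^sub>R A x))\<^sup>2 = G t t - 2 * t * G t 1 + t * t * G 1 1"
    by (simp add: power2_norm_eq_inner G_def inner_diff_left inner_diff_right
        inner_commute[of "A x" "A (t *\<^sub>R x)"] algebra_simps)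
  also have "\<dots> = 0"
    using g[of t] g[of "t * t"] by (simp add: G)
  finally show "A (t *\<^sub>R x) = t *\<^sub>R A x" by simp
  show "norm (A x) = norm (A y)"
    using GH[of 1 1 1 1] by (simp add: G_def H_def norm_eq_sqrt_inner)
qed

theorem linear: "linear A"
proof (rule linearI)
  show "A (t *\<^sub>R x) = t *\<^sub>R A x" for t x
  proof (cases "x = 0")
    case False
    obtain w where "w \<noteq> 0" "perp x w" by (rule ex_partner)
    then obtain r where "perp x (r *\<^sub>R w)" "norm (r *\<^sub>R w) = norm x"
      using equal_norm_partner[of x w] False by blast
    then show ?thesis using perp_frame(1) by metis
  qed (simp add: A_zero)
qed (rule A_add)

lemma norm_proportional_perp:
  assumes "perp x y"
  shows "norm (A x) * norm y = norm (A y) * norm x"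
proof (cases "x = 0 \<or> y = 0")
  case False
  then obtain r where r: "r \<noteq> 0" "perp x (r *\<^sub>R y)" "norm (r *\<^sub>R y) = norm x"
    using equal_norm_partner[OF assms] by blast
  then have "norm (A x) = norm (A (r *\<^sub>R y))" using perp_frame(2) by metis
  then show ?thesis
    using r(3) by (simp add: linear_scale[OF linear] flip: r(3))
qed (auto simp: A_zero)

text \<open>
  Split \<open>y = p + z\<close> along \<open>x\<close>. The case of orthogonal vectors compares \<open>x\<close> with \<open>z\<close>, and \<open>x\<close>
  with \<open>p\<close> by way of a common partner; Pythagoras' theorem, before and after applying \<open>A\<close>,
  combines the two.
\<close>

lemma norm_proportional: "norm (A x) * norm y = norm (A y) * norm x"
proof (cases "x = 0")
  case False
  obtain p z where pz: "y = p + z" "perp x z" and p: "\<And>w. perp x w \<Longrightarrow> perp p w"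
    using project[of y x] by blast
  obtain w where w: "w \<noteq> 0" "perp x w" by (rule ex_partner)
  have "norm (A p) * norm x * norm w = norm (A x) * norm p * norm w"
    using norm_proportional_perp[OF w(2)] norm_proportional_perp[OF p[OF w(2)]]
    by (simp add: ac_simps)
  then have P: "norm (A p) * norm x = norm (A x) * norm p" using w by simp
  have Z: "norm (A z) * norm x = norm (A x) * norm z"
    using norm_proportional_perp[OF pz(2)] by simp
  have y: "(norm y)\<^sup>2 = (norm p)\<^sup>2 + (norm z)\<^sup>2"
    unfolding pz(1) by (rule norm_add_Pythagorean_inner) (rule perp_inner[OF p[OF pz(2)]])
  have Ay: "(norm (A y))\<^sup>2 = (norm (A p))\<^sup>2 + (norm (A z))\<^sup>2"
    unfolding pz(1) A_add by (rule norm_add_Pythagorean_inner) (rule preserves[OF p[OF pz(2)]])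
  have "(norm (A y) * norm x)\<^sup>2 = (norm (A p) * norm x)\<^sup>2 + (norm (A z) * norm x)\<^sup>2"
    by (simp add: power_mult_distrib Ay distrib_right)
  also have "\<dots> = (norm (A x) * norm y)\<^sup>2"
    unfolding P Z by (simp add: power_mult_distrib y distrib_left)
  finally show ?thesis
    by (simp add: power2_eq_iff_nonneg)
qed (simp add: A_zero)

theorem scales_norm: "\<exists>c. \<forall>x. norm (A x) = c * norm x"
proof -
  obtain e :: 'a where "e \<noteq> 0" using nontrivial by blast
  then have "norm (A x) = norm (A e) / norm e * norm x" for x
    using norm_proportional[of e x] by (simp add: field_simps)
  then show ?thesis by blast
qed

lemma bounded_linear: "bounded_linear A"
proof -
  obtain c where "\<forall>x. norm (A x) = c * norm x" using scales_norm by blast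
  then show ?thesis
    by (intro bounded_linear.intro linear bounded_linear_axioms.intro exI[of _ c])
      (simp add: mult.commute)
qed

end

section \<open>Extension to completions\<close>

lemma dense_range_sequence:
  fixes f :: "'a \<Rightarrow> 'b::first_countable_topology"
  assumes "closure (range f) = UNIV"
  obtains u where "(\<lambda>n. f (u n)) \<longlonglongrightarrow> x"
proof -
  have "x \<in> closure (range f)" using assms by simp
  then obtain s where "\<forall>n. s n \<in> range f" "s \<longlonglongrightarrow> x"
    unfolding closure_sequential by blast
  then show thesis
    using that[of "\<lambda>n. inv f (s n)"] by (simp add: f_inv_into_f)
qed

lemma is_completion_norm:
  assumes "is_completion \<iota>" shows "norm (\<iota> x) = norm x"
  using assms by (simp add: is_completion_def norm_eq_sqrt_inner)

lemma is_completion_eq_0_iff: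
  assumes "is_completion \<iota>" shows "\<iota> x = 0 \<longleftrightarrow> x = 0"
  using is_completion_norm[OF assms, of x] by auto

lemma scaled_isometry_extension:
  fixes A :: "'a::real_inner \<Rightarrow> 'b::real_inner"
    and \<iota> :: "'a \<Rightarrow> 'c::{real_inner, complete_space}"
    and \<kappa> :: "'b \<Rightarrow> 'd::{real_inner, complete_space}"
  assumes A: "linear A" and norm_A: "\<And>x. norm (A x) = c * norm x"
    and \<iota>: "is_completion \<iota>" and \<kappa>: "is_completion \<kappa>"
  obtains B where "linear B" "\<And>x. norm (B x) = c * norm x" "\<And>x. B (\<iota> x) = \<kappa> (A x)"
proof -
  have lin: "linear \<iota>" "linear \<kappa>" and dense: "closure (range \<iota>) = UNIV"
    using \<iota> \<kappa> by (auto simp: is_completion_def)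
  have inj: "inj \<iota>"
    using is_completion_eq_0_iff[OF \<iota>] by (simp add: linear_injective_0[OF lin(1)])
  define f where "f = \<kappa> \<circ> A \<circ> inv \<iota>"
  have f: "f (\<iota> x) = \<kappa> (A x)" for x using inj by (simp add: f_def)
  have "dist (f (\<iota> x)) (f (\<iota> y)) = c * dist (\<iota> x) (\<iota> y)" for x y
    by (simp add: f dist_norm linear_diff[OF A, symmetric] linear_diff[OF lin(1), symmetric]
        linear_diff[OF lin(2), symmetric] is_completion_norm[OF \<iota>] is_completion_norm[OF \<kappa>] norm_A)
  then have "dist (f x) (f y) \<le> \<bar>c\<bar> * dist x y" if "x \<in> range \<iota>" "y \<in> range \<iota>" for x y
    using that by (auto intro!: mult_right_mono)
  then have "\<bar>c\<bar>-lipschitz_on (range \<iota>) f" by (intro lipschitz_onI) auto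
  then have "uniformly_continuous_on (range \<iota>) f"
    by (rule lipschitz_on_uniformly_continuous)
  then obtain B where "uniformly_continuous_on (closure (range \<iota>)) B"
    and ext: "\<And>x. x \<in> range \<iota> \<Longrightarrow> f x = B x"
    by (rule uniformly_continuous_on_extension_on_closure) (rule that)
  then have cont: "isCont B x" for x
    using uniformly_continuous_imp_continuous dense
    by (metis continuous_on_eq_continuous_at open_UNIV UNIV_I)
  have B: "B (\<iota> x) = \<kappa> (A x)" for x using ext[of "\<iota> x"] by (simp add: f)
  have lim: "(\<lambda>n. \<kappa> (A (u n))) \<longlonglongrightarrow> B x" if "(\<lambda>n. \<iota> (u n)) \<longlonglongrightarrow> x" for u x
    using isCont_tendsto_compose[OF cont that] by (simp add: B)
  have norm_B: "norm (B x) = c * norm x" for x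
  proof -
    obtain u where u: "(\<lambda>n. \<iota> (u n)) \<longlonglongrightarrow> x" using dense by (rule dense_range_sequence)
    have "(\<lambda>n. c * norm (\<iota> (u n))) \<longlonglongrightarrow> norm (B x)"
      using tendsto_norm[OF lim[OF u]]
      by (simp add: is_completion_norm[OF \<iota>] is_completion_norm[OF \<kappa>] norm_A)
    then show ?thesis
      by (rule LIMSEQ_unique) (intro tendsto_intros u)
  qed
  have "linear B"
  proof (rule linearI)
    fix x y
    obtain u where u: "(\<lambda>n. \<iota> (u n)) \<longlonglongrightarrow> x" using dense by (rule dense_range_sequence)
    obtain v where v: "(\<lambda>n. \<iota> (v n)) \<longlonglongrightarrow> y" using dense by (rule dense_range_sequence)
    have "(\<lambda>n. \<kappa> (A (u n + v n))) \<longlonglongrightarrow> B (x + y)"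
      by (rule lim) (simp add: linear_add[OF lin(1)] tendsto_add u v)
    then have "(\<lambda>n. \<kappa> (A (u n)) + \<kappa> (A (v n))) \<longlonglongrightarrow> B (x + y)"
      by (simp add: linear_add[OF A] linear_add[OF lin(2)])
    then show "B (x + y) = B x + B y"
      by (rule LIMSEQ_unique) (intro tendsto_add lim u v)
  next
    fix r x
    obtain u where u: "(\<lambda>n. \<iota> (u n)) \<longlonglongrightarrow> x" using dense by (rule dense_range_sequence)
    have "(\<lambda>n. \<kappa> (A (r *\<^sub>R u n))) \<longlonglongrightarrow> B (r *\<^sub>R x)"
      by (rule lim) (simp add: linear_scale[OF lin(1)] tendsto_scaleR u)
    then have "(\<lambda>n. r *\<^sub>R \<kappa> (A (u n))) \<longlonglongrightarrow> B (r *\<^sub>R x)"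
      by (simp add: linear_scale[OF A] linear_scale[OF lin(2)])
    then show "B (r *\<^sub>R x) = r *\<^sub>R B x"
      by (rule LIMSEQ_unique) (intro tendsto_scaleR tendsto_const lim u)
  qed
  then show thesis using that norm_B B by blast
qed

lemma eq_on_dense_range:
  fixes B C :: "'b::real_normed_vector \<Rightarrow> 'c::real_normed_vector"
  assumes "closure (range f) = UNIV" "bounded_linear B" "bounded_linear C"
    and eq: "\<And>x. B (f x) = C (f x)"
  shows "B = C"
proof
  fix x
  obtain u where u: "(\<lambda>n. f (u n)) \<longlonglongrightarrow> x" using assms(1) by (rule dense_range_sequence)
  have "(\<lambda>n. B (f (u n))) \<longlonglongrightarrow> B x" "(\<lambda>n. B (f (u n))) \<longlonglongrightarrow> C x"
    using bounded_linear.tendsto[OF assms(2) u] bounded_linear.tendsto[OF assms(3) u]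
    by (simp_all add: eq)
  then show "B x = C x" by (rule LIMSEQ_unique)
qed

section \<open>Real inner product spaces\<close>

lemma real_dim_at_least_2_perp:
  assumes "vector_space.dim_at_least (scaleR :: real \<Rightarrow> 'a \<Rightarrow> 'a::real_inner) 2"
  shows "\<exists>x y :: 'a. x \<noteq> 0 \<and> y \<noteq> 0 \<and> inner x y = 0"
proof -
  obtain S :: "'a set" where S: "independent S" "infinite S \<or> 2 \<le> card S"
    using assms unfolding real_vector.dim_at_least_def dependent_raw_def by auto
  obtain T where T: "T \<subseteq> S" "card T = 2"
    using S(2) by (metis infinite_arbitrarily_large obtain_subset_with_card_n)
  obtain u v where uv: "T = {u, v}" "u \<noteq> v" using T(2) by (auto simp: card_2_iff)
  have ind: "independent {v, u}"
    using independent_mono[OF S(1) T(1)] uv by (simp add: insert_commute)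
  then have u: "u \<noteq> 0" using dependent_zero by blast
  define w where "w = v - (inner v u / inner u u) *\<^sub>R u"
  have "w \<noteq> 0"
  proof
    assume "w = 0"
    then have "v \<in> span {u}" by (simp add: w_def span_singleton)
    then show False using ind uv(2) by (simp add: independent_insert)
  qed
  moreover have "inner u w = 0"
    using u by (simp add: w_def inner_diff_right inner_commute)
  ultimately show ?thesis using u by blast
qed

lemma real_orthogonality:
  assumes "\<exists>x y :: 'a::real_inner. x \<noteq> 0 \<and> y \<noteq> 0 \<and> inner x y = 0"
  shows "orthogonality (\<lambda>x y :: 'a. inner x y = 0)"
proof
  fix x y :: 'a and a b c d :: real
  assume *: "inner x y = 0" "norm x = norm y" "a * c + b * d = 0"
  have "inner (a *\<^sub>R x + b *\<^sub>R y) (c *\<^sub>R x + d *\<^sub>R y) = (a * c + b * d) * inner x x"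
    using *(1,2) by (simp add: inner_add_left inner_add_right inner_commute norm_eq distrib_right
        mult.assoc)
  then show "inner (a *\<^sub>R x + b *\<^sub>R y) (c *\<^sub>R x + d *\<^sub>R y) = 0" using *(3) by simp
next
  fix x y :: 'a
  let ?p = "(inner y x / inner x x) *\<^sub>R x"
  show "\<exists>p z. y = p + z \<and> inner x z = 0 \<and> (\<forall>w. inner x w = 0 \<longrightarrow> inner p w = 0)"
    by (rule exI[of _ ?p], rule exI[of _ "y - ?p"])
      (auto simp: inner_diff_right inner_commute)
qed (use assms in \<open>auto simp: inner_commute\<close>)

lemma real_additive_orthogonal:
  assumes "\<exists>x y :: 'a::real_inner. x \<noteq> 0 \<and> y \<noteq> 0 \<and> inner x y = 0"
    and "Modules.additive A" "preserves_orthogonality A"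
  shows "additive_orthogonal (\<lambda>x y :: 'a. inner x y = 0) A"
  using assms
  by (intro additive_orthogonal.intro real_orthogonality additive_orthogonal_axioms.intro)
    (auto simp: preserves_orthogonality_def)

lemma linear_imp_additive: "linear f \<Longrightarrow> Modules.additive f"
  by (simp add: Modules.additive_def linear_add)

lemma scaled_isometry_inner:
  fixes B :: "'a::real_inner \<Rightarrow> 'b::real_inner"
  assumes "linear B" "\<And>x. norm (B x) = c * norm x"
  shows "inner (B x) (B y) = c\<^sup>2 * inner x y"
  by (simp add: dot_norm linear_add[OF assms(1), symmetric] assms(2) power_mult_distrib
      right_diff_distrib)

theorem real_unique_extension:
  fixes A :: "'h::real_inner \<Rightarrow> 'k::real_inner"
    and \<iota> :: "'h \<Rightarrow> 'hc::{real_inner, complete_space}"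
    and \<kappa> :: "'k \<Rightarrow> 'kc::{real_inner, complete_space}"
  assumes nontrivial: "\<exists>x y :: 'h. x \<noteq> 0 \<and> y \<noteq> 0 \<and> inner x y = 0"
    and A: "Modules.additive A" "preserves_orthogonality A"
    and \<iota>: "is_completion \<iota>" and \<kappa>: "is_completion \<kappa>"
  shows "\<exists>!B :: 'hc \<Rightarrow> 'kc. linear B \<and> preserves_orthogonality B \<and> (\<forall>x. B (\<iota> x) = \<kappa> (A x))"
proof -
  interpret A: additive_orthogonal "\<lambda>x y. inner x y = 0" A
    using nontrivial A by (rule real_additive_orthogonal)
  obtain c where "\<forall>x. norm (A x) = c * norm x" using A.scales_norm by blast
  then obtain B where B: "linear B" "\<And>x. norm (B x) = c * norm x" "\<And>x. B (\<iota> x) = \<kappa> (A x)"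
    using scaled_isometry_extension[OF A.linear _ \<iota> \<kappa>] by blast
  have pres: "preserves_orthogonality B"
    by (simp add: preserves_orthogonality_def scaled_isometry_inner[OF B(1,2)])
  obtain u v :: 'h where "u \<noteq> 0" "v \<noteq> 0" "inner u v = 0" using nontrivial by blast
  then have "\<iota> u \<noteq> 0" "\<iota> v \<noteq> 0" "inner (\<iota> u) (\<iota> v) = 0"
    using \<iota> by (simp_all add: is_completion_eq_0_iff[OF \<iota>] is_completion_def)
  then have "\<exists>x y :: 'hc. x \<noteq> 0 \<and> y \<noteq> 0 \<and> inner x y = 0" by blast
  then have bl: "bounded_linear C"
    if "linear C" "preserves_orthogonality C" for C :: "'hc \<Rightarrow> 'kc"
    using that by (intro additive_orthogonal.bounded_linear[OF real_additive_orthogonal]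
        linear_imp_additive)
  show ?thesis
  proof (rule ex1I[of _ B])
    fix C assume C: "linear C \<and> preserves_orthogonality C \<and> (\<forall>x. C (\<iota> x) = \<kappa> (A x))"
    show "C = B"
      by (rule eq_on_dense_range[of \<iota>]) (use \<iota> C B pres bl in \<open>auto simp: is_completion_def\<close>)
  qed (use B pres in auto)
qed

section \<open>Complex inner product spaces\<close>

lemma cinner_add_right: "cinner x (y + z) = cinner x y + cinner x z"
  by (metis cinner_commute cinner_add_left complex_cnj_add)

lemma cinner_scaleC_right: "cinner x (a *\<^sub>C y) = cnj a * cinner x y"
  by (metis cinner_commute cinner_scaleC_left complex_cnj_mult)

lemma cinner_scaleR_left: "cinner (r *\<^sub>R x) y = of_real r * cinner x y"
  by (simp add: scaleR_scaleC cinner_scaleC_left)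

lemma cinner_scaleR_right: "cinner x (r *\<^sub>R y) = of_real r * cinner x y"
  by (simp add: scaleR_scaleC cinner_scaleC_right)

lemma cinner_diff_right: "cinner x (y - z) = cinner x y - cinner x z"
  using cinner_add_right[of x "y - z" z] by simp

lemma cinner_eq_0_commute: "cinner x y = 0 \<longleftrightarrow> cinner y x = 0"
  by (metis cinner_commute complex_cnj_zero)

lemma cinner_projection: "cinner x (y - (cinner y x / cinner x x) *\<^sub>C x) = 0"
proof (cases "x = 0")
  case True
  then show ?thesis using cinner_scaleR_left[of 0 0] by simp
next
  case False
  then show ?thesis
    using cinner_commute[of x y]
    by (simp add: cinner_diff_right cinner_scaleC_right cinner_self)
qed

lemma norm_scaleC:
  fixes x :: "'a::complex_inner"
  shows "norm (a *\<^sub>C x) = cmod a * norm x"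
proof -
  have "complex_of_real ((norm (a *\<^sub>C x))\<^sup>2) = a * cnj a * cinner x x"
    by (simp only: cinner_self[symmetric] cinner_scaleC_left cinner_scaleC_right ac_simps)
  also have "\<dots> = complex_of_real ((cmod a * norm x)\<^sup>2)"
    by (simp only: cinner_self complex_norm_square[symmetric] power_mult_distrib of_real_mult)
  finally have "(norm (a *\<^sub>C x))\<^sup>2 = (cmod a * norm x)\<^sup>2" by (simp only: of_real_eq_iff)
  then show ?thesis by (simp add: power2_eq_iff_nonneg)
qed

lemma cinner_eq_inner: "cinner x y = Complex (inner x y) (inner x (\<i> *\<^sub>C y))"
  by (simp add: complex_eq_iff inner_eq_Re_cinner cinner_scaleC_right)

lemma bounded_linear_scaleC: "bounded_linear (\<lambda>x :: 'a::complex_inner. a *\<^sub>C x)"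
  by (rule bounded_linear_intro[of _ "cmod a"])
    (simp_all add: scaleC_add_right scaleR_scaleC scaleC_scaleC norm_scaleC mult.commute)

lemma tendsto_cinner:
  assumes "(f \<longlongrightarrow> x) F" "(g \<longlongrightarrow> y) F"
  shows "((\<lambda>n. cinner (f n) (g n)) \<longlongrightarrow> cinner x y) F"
  unfolding cinner_eq_inner
  by (intro tendsto_Complex tendsto_inner assms bounded_linear.tendsto[OF bounded_linear_scaleC])

lemma complex_dim_at_least_2_perp:
  assumes "vector_space.dim_at_least (scaleC :: complex \<Rightarrow> 'a \<Rightarrow> 'a::complex_inner) 2"
  shows "\<exists>x y :: 'a. x \<noteq> 0 \<and> y \<noteq> 0 \<and> cinner x y = 0"
proof -
  obtain S :: "'a set" where S: "complex_vector.independent S" "infinite S \<or> 2 \<le> card S"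
    using assms unfolding complex_vector.dim_at_least_def by auto
  obtain T where T: "T \<subseteq> S" "card T = 2"
    using S(2) by (metis infinite_arbitrarily_large obtain_subset_with_card_n)
  obtain u v where uv: "T = {u, v}" "u \<noteq> v" using T(2) by (auto simp: card_2_iff)
  have ind: "complex_vector.independent {v, u}"
    using complex_vector.independent_mono[OF S(1) T(1)] uv by (simp add: insert_commute)
  then have u: "u \<noteq> 0" using complex_vector.dependent_zero by blast
  define w where "w = v - (cinner v u / cinner u u) *\<^sub>C u"
  have "w \<noteq> 0"
  proof
    assume "w = 0"
    then have "v \<in> complex_vector.span {u}" by (simp add: w_def complex_vector.span_singleton)
    then show False
      using ind uv(2) by (simp add: complex_vector.independent_insert)
  qed
  moreover have "cinner u w = 0"
    unfolding w_def by (rule cinner_projection)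
  ultimately show ?thesis using u by blast
qed

lemma complex_orthogonality:
  assumes "\<exists>x y :: 'a::complex_inner. x \<noteq> 0 \<and> y \<noteq> 0 \<and> cinner x y = 0"
  shows "orthogonality (\<lambda>x y :: 'a. cinner x y = 0)"
proof
  fix x y :: 'a and a b c d :: real
  assume *: "cinner x y = 0" "norm x = norm y" "a * c + b * d = 0"
  then have "cinner y x = 0" by (simp add: cinner_eq_0_commute)
  then have "cinner (a *\<^sub>R x + b *\<^sub>R y) (c *\<^sub>R x + d *\<^sub>R y)
      = of_real (a * c + b * d) * cinner x x"
    using *(1,2) by (simp add: cinner_add_left cinner_add_right cinner_scaleR_left
        cinner_scaleR_right cinner_self distrib_right mult.assoc)
  then show "cinner (a *\<^sub>R x + b *\<^sub>R y) (c *\<^sub>R x + d *\<^sub>R y) = 0" using *(3) by simp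
next
  fix x y :: 'a
  let ?p = "(cinner y x / cinner x x) *\<^sub>C x"
  have "cinner x (y - ?p) = 0"
    by (rule cinner_projection)
  then show "\<exists>p z. y = p + z \<and> cinner x z = 0 \<and> (\<forall>w. cinner x w = 0 \<longrightarrow> cinner p w = 0)"
    by (intro exI[of _ ?p] exI[of _ "y - ?p"]) (auto simp: cinner_scaleC_left)
qed (use assms in \<open>auto simp: cinner_eq_0_commute inner_eq_Re_cinner cinner_scaleR_right\<close>)

lemma complex_additive_orthogonal:
  assumes "\<exists>x y :: 'a::complex_inner. x \<noteq> 0 \<and> y \<noteq> 0 \<and> cinner x y = 0"
    and "Modules.additive A" "preserves_corthogonality A"
  shows "additive_orthogonal (\<lambda>x y :: 'a. cinner x y = 0) A"
  using assms
  by (intro additive_orthogonal.intro complex_orthogonality additive_orthogonal_axioms.intro)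
    (auto simp: preserves_corthogonality_def inner_eq_Re_cinner)

lemma is_ccompletion_imp_is_completion:
  assumes "is_ccompletion \<iota>"
  shows "is_completion \<iota>"
proof -
  interpret c: Vector_Spaces.linear scaleC scaleC \<iota>
    using assms by (simp add: is_ccompletion_def)
  have "linear \<iota>" by (rule linearI) (simp_all add: c.add c.scale scaleR_scaleC)
  then show ?thesis
    using assms by (simp add: is_completion_def is_ccompletion_def inner_eq_Re_cinner)
qed

text \<open>
  For orthogonal \<open>x \<noteq> 0\<close> and \<open>y\<close>, approximate both from the dense subspace and remove from the
  approximations of \<open>y\<close> their components along those of \<open>x\<close>. The removed components tend to \<open>0\<close>
  because \<open>cinner y x = 0\<close>, so the corrected vectors still approximate \<open>y\<close>.
\<close>

lemma preserves_corthogonality_extension: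
  fixes A :: "'h::complex_inner \<Rightarrow> 'k::complex_inner"
    and \<iota> :: "'h \<Rightarrow> 'hc::{complex_inner, complete_space}"
    and \<kappa> :: "'k \<Rightarrow> 'kc::{complex_inner, complete_space}"
  assumes A: "preserves_corthogonality A"
    and \<iota>: "is_ccompletion \<iota>" and \<kappa>: "is_ccompletion \<kappa>"
    and B: "bounded_linear B" "\<And>x. B (\<iota> x) = \<kappa> (A x)"
  shows "preserves_corthogonality B"
  unfolding preserves_corthogonality_def
proof (intro allI impI)
  fix x y :: 'hc
  assume xy: "cinner x y = 0"
  show "cinner (B x) (B y) = 0"
  proof (cases "x = 0")
    case True
    then show ?thesis
      using cinner_scaleR_left[of 0 0 "B y"] by (simp add: linear_simps(3)[OF B(1)])
  next
    case False
    interpret c: Vector_Spaces.linear scaleC scaleC \<iota>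
      using \<iota> by (simp add: is_ccompletion_def)
    have dense: "closure (range \<iota>) = UNIV" using \<iota> by (simp add: is_ccompletion_def)
    obtain u where u: "(\<lambda>n. \<iota> (u n)) \<longlonglongrightarrow> x" using dense by (rule dense_range_sequence)
    obtain v where v: "(\<lambda>n. \<iota> (v n)) \<longlonglongrightarrow> y" using dense by (rule dense_range_sequence)
    define a where "a n = cinner (v n) (u n) / cinner (u n) (u n)" for n
    define w where "w n = v n - a n *\<^sub>C u n" for n
    have perp: "cinner (u n) (w n) = 0" for n
      unfolding w_def a_def by (rule cinner_projection)
    have "(\<lambda>n. cinner (\<iota> (v n)) (\<iota> (u n)) / cinner (\<iota> (u n)) (\<iota> (u n)))
        \<longlonglongrightarrow> cinner y x / cinner x x"
      by (intro tendsto_divide tendsto_cinner u v) (simp add: cinner_self False)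
    moreover have "cinner y x = 0" using xy cinner_eq_0_commute by blast
    moreover have "cinner (\<iota> p) (\<iota> q) = cinner p q" for p q
      using \<iota> by (simp add: is_ccompletion_def)
    ultimately have "a \<longlonglongrightarrow> 0" by (simp add: a_def[abs_def])
    then have "(\<lambda>n. cmod (a n) * norm (\<iota> (u n))) \<longlonglongrightarrow> 0 * norm x"
      by (intro tendsto_mult tendsto_norm_zero tendsto_norm u)
    then have "(\<lambda>n. a n *\<^sub>C \<iota> (u n)) \<longlonglongrightarrow> 0"
      by - (rule tendsto_norm_zero_cancel, simp add: norm_scaleC)
    from tendsto_diff[OF v this] have w: "(\<lambda>n. \<iota> (w n)) \<longlonglongrightarrow> y"
      by (simp add: w_def c.diff c.scale)
    have "(\<lambda>n. cinner (B (\<iota> (u n))) (B (\<iota> (w n)))) \<longlonglongrightarrow> cinner (B x) (B y)"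
      by (intro tendsto_cinner bounded_linear.tendsto[OF B(1)] u w)
    moreover have "cinner (B (\<iota> (u n))) (B (\<iota> (w n))) = 0" for n
      using perp A \<kappa> by (simp add: B(2) is_ccompletion_def preserves_corthogonality_def)
    ultimately show ?thesis by (simp add: LIMSEQ_const_iff)
  qed
qed

theorem complex_unique_extension:
  fixes A :: "'h::complex_inner \<Rightarrow> 'k::complex_inner"
    and \<iota> :: "'h \<Rightarrow> 'hc::{complex_inner, complete_space}"
    and \<kappa> :: "'k \<Rightarrow> 'kc::{complex_inner, complete_space}"
  assumes nontrivial: "\<exists>x y :: 'h. x \<noteq> 0 \<and> y \<noteq> 0 \<and> cinner x y = 0"
    and A: "Modules.additive A" "preserves_corthogonality A"
    and c\<iota>: "is_ccompletion \<iota>" and c\<kappa>: "is_ccompletion \<kappa>"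
  shows "\<exists>!B :: 'hc \<Rightarrow> 'kc. linear B \<and> preserves_corthogonality B \<and> (\<forall>x. B (\<iota> x) = \<kappa> (A x))"
proof -
  interpret A: additive_orthogonal "\<lambda>x y. cinner x y = 0" A
    using nontrivial A by (rule complex_additive_orthogonal)
  have \<iota>: "is_completion \<iota>" and \<kappa>: "is_completion \<kappa>"
    using c\<iota> c\<kappa> by (simp_all add: is_ccompletion_imp_is_completion)
  obtain c where "\<forall>x. norm (A x) = c * norm x" using A.scales_norm by blast
  then obtain B where B: "linear B" "\<And>x. norm (B x) = c * norm x" "\<And>x. B (\<iota> x) = \<kappa> (A x)"
    using scaled_isometry_extension[OF A.linear _ \<iota> \<kappa>] by blast
  have "bounded_linear B"
    by (intro bounded_linear.intro B(1) bounded_linear_axioms.intro exI[of _ c])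
      (simp add: B(2) mult.commute)
  then have pres: "preserves_corthogonality B"
    using preserves_corthogonality_extension[OF A(2) c\<iota> c\<kappa>] B(3) by blast
  obtain u v :: 'h where "u \<noteq> 0" "v \<noteq> 0" "cinner u v = 0" using nontrivial by blast
  then have "\<iota> u \<noteq> 0" "\<iota> v \<noteq> 0" "cinner (\<iota> u) (\<iota> v) = 0"
    using c\<iota> by (simp_all add: is_completion_eq_0_iff[OF \<iota>] is_ccompletion_def)
  then have "\<exists>x y :: 'hc. x \<noteq> 0 \<and> y \<noteq> 0 \<and> cinner x y = 0" by blast
  then have bl: "bounded_linear C"
    if "linear C" "preserves_corthogonality C" for C :: "'hc \<Rightarrow> 'kc"
    using that by (intro additive_orthogonal.bounded_linear[OF complex_additive_orthogonal]
        linear_imp_additive)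
  show ?thesis
  proof (rule ex1I[of _ B])
    fix C assume C: "linear C \<and> preserves_corthogonality C \<and> (\<forall>x. C (\<iota> x) = \<kappa> (A x))"
    show "C = B"
      by (rule eq_on_dense_range[of \<iota>]) (use \<iota> C B pres bl in \<open>auto simp: is_completion_def\<close>)
  qed (use B pres in auto)
qed

section \<open>The extension theorem\<close>

theorem lemma2p12:
  fixes A :: "'h::real_inner \<Rightarrow> 'k::real_inner"
    and \<iota>\<^sub>H :: "'h \<Rightarrow> 'hc::{real_inner, complete_space}"
    and \<iota>\<^sub>K :: "'k \<Rightarrow> 'kc::{real_inner, complete_space}"
    and A' :: "'ch::complex_inner \<Rightarrow> 'ck::complex_inner"
    and \<kappa>\<^sub>H :: "'ch \<Rightarrow> 'chc::{complex_inner, complete_space}"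
    and \<kappa>\<^sub>K :: "'ck \<Rightarrow> 'ckc::{complex_inner, complete_space}"
  shows
    "(vector_space.dim_at_least (scaleR :: real \<Rightarrow> 'h \<Rightarrow> 'h) 2 \<and>
      Modules.additive A \<and> preserves_orthogonality A \<longrightarrow>
        linear A \<and>
        (is_completion \<iota>\<^sub>H \<and> is_completion \<iota>\<^sub>K \<longrightarrow>
          (\<exists>!B :: 'hc \<Rightarrow> 'kc. linear B \<and> preserves_orthogonality B \<and>
            (\<forall>x. B (\<iota>\<^sub>H x) = \<iota>\<^sub>K (A x))))) \<and>
     (vector_space.dim_at_least (scaleC :: complex \<Rightarrow> 'ch \<Rightarrow> 'ch) 2 \<and>
      Modules.additive A' \<and> preserves_corthogonality A' \<longrightarrow>
        linear A' \<and>
        (is_ccompletion \<kappa>\<^sub>H \<and> is_ccompletion \<kappa>\<^sub>K \<longrightarrow>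
          (\<exists>!B :: 'chc \<Rightarrow> 'ckc. linear B \<and> preserves_corthogonality B \<and>
            (\<forall>x. B (\<kappa>\<^sub>H x) = \<kappa>\<^sub>K (A' x)))))"
proof (intro conjI impI; elim conjE)
  assume "vector_space.dim_at_least (scaleR :: real \<Rightarrow> 'h \<Rightarrow> 'h) 2"
    and A: "Modules.additive A" "preserves_orthogonality A"
  note perp = real_dim_at_least_2_perp[OF this(1)]
  show "linear A"
    using real_additive_orthogonal[OF perp A] by (rule additive_orthogonal.linear)
  assume "is_completion \<iota>\<^sub>H" "is_completion \<iota>\<^sub>K"
  with perp A show "\<exists>!B :: 'hc \<Rightarrow> 'kc. linear B \<and> preserves_orthogonality B \<and>
      (\<forall>x. B (\<iota>\<^sub>H x) = \<iota>\<^sub>K (A x))"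
    by (rule real_unique_extension)
next
  assume "vector_space.dim_at_least (scaleC :: complex \<Rightarrow> 'ch \<Rightarrow> 'ch) 2"
    and A': "Modules.additive A'" "preserves_corthogonality A'"
  note perp = complex_dim_at_least_2_perp[OF this(1)]
  show "linear A'"
    using complex_additive_orthogonal[OF perp A'] by (rule additive_orthogonal.linear)
  assume "is_ccompletion \<kappa>\<^sub>H" "is_ccompletion \<kappa>\<^sub>K"
  with perp A' show "\<exists>!B :: 'chc \<Rightarrow> 'ckc. linear B \<and> preserves_corthogonality B \<and>
      (\<forall>x. B (\<kappa>\<^sub>H x) = \<kappa>\<^sub>K (A' x))"
    by (rule complex_unique_extension)
qed

end
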